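(* Let $S$ be an infinite set, $D$ a positive integer and $V=S^D$. Let $A$ be a system consisting of set-polynomials with empty constant terms. Then $A$ is a system of recurrence: for every compact metric space $(X,\rho)$, every action $T$ of $\mathcal{F}(V)$ on $X$, every $\varepsilon>0$ and every $H\in\mathcal{F}(S)$ there exists $N\in\mathcal{F}(S)$ with $N\cap H=\emptyset$ such that for every $x\in X$ there exist a nonempty set $n\subseteq N$ and a set $a\subseteq\bigcup_{P\in A}P(N)$ such that for every $P\in A$ one has $a\cap P(n)=\emptyset$ and $\rho(T^{a\cup P(n)}x,\,T^a x)<\varepsilon$.
   Context: For a set $W$, $\mathcal{F}(W)$ is the set of finite subsets of $W$ (including $\emptyset$). For $s=(s_1,\dots,s_D)\in V$ and $\beta=\{i_1<\dots<i_k\}\subseteq\{1,\dots,D\}$ write $s_\beta=(s_{i_1},\dots,s_{i_k})\in S^k$, with the conventions $S^0=\{\emptyset\}$ and $s_\emptyset=\emptyset$. For $\alpha\subseteq\{1,\dots,D\}$ let $\bar\alpha=\{1,\dots,D\}\setminus\alpha$. A set-polynomial $P$ is given by coefficients $P_\alpha\in\mathcal{F}(S^{|\bar\alpha|})$, $\alpha\subseteq\{1,\dots,D\}$, and is the map $P:\mathcal{F}(S)\to\mathcal{F}(V)$, $$P(n)=\bigcup_{\alpha\subseteq\{1,\dots,D\}}\{s\in V:\ s_{\bar\alpha}\in P_\alpha \text{ and } s_i\in n \text{ for all } i\in\alpha\}.$$ Its constant term is $P_\emptyset$; "empty constant term" means $P_\emptyset=\emptyset$. A system is a finite set of set-polynomials.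 An action of $\mathcal{F}(V)$ on $X$ is a map $a\mapsto T^a$ into the continuous self-maps of $X$ with $T^{a\cup b}=T^aT^b$ whenever $a,b\in\mathcal{F}(V)$ are disjoint. *)

theory Defs
  imports "HOL-Analysis.Analysis"
begin

text \<open>
  Tuples are lists and coordinates are numbered from 0, so the index set is \<open>{..<D}\<close> and
  the subtuple of \<open>s\<close> with positions in \<open>\<beta>\<close> is \<open>nths s \<beta>\<close>; in particular \<open>nths s {} = []\<close>.
\<close>

definition tuples :: "'s set \<Rightarrow> nat \<Rightarrow> 's list set" where
  "tuples S k = {s. length s = k \<and> set s \<subseteq> S}"

text \<open>
  A set-polynomial is represented by its family of coefficients; the values of the family
  at arguments that are not subsets of \<open>{..<D}\<close> are irrelevant.
\<close>

type_synonym 's setpoly = "nat set \<Rightarrow> 's list set"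

definition set_polynomial :: "'s set \<Rightarrow> nat \<Rightarrow> 's setpoly \<Rightarrow> bool" where
  "set_polynomial S D P \<longleftrightarrow>
     (\<forall>\<alpha>. \<alpha> \<subseteq> {..<D} \<longrightarrow> P \<alpha> \<in> Fpow (tuples S (card ({..<D} - \<alpha>))))"

definition poly_map :: "'s set \<Rightarrow> nat \<Rightarrow> 's setpoly \<Rightarrow> 's set \<Rightarrow> 's list set" where
  "poly_map S D P n =
     (\<Union>\<alpha>\<in>Pow {..<D}.
        {s \<in> tuples S D. nths s ({..<D} - \<alpha>) \<in> P \<alpha> \<and> (\<forall>i\<in>\<alpha>. s ! i \<in> n)})"

definition constant_term :: "'s setpoly \<Rightarrow> 's list set" where
  "constant_term P = P {}"

definition poly_system :: "'s set \<Rightarrow> nat \<Rightarrow> 's setpoly set \<Rightarrow> bool" where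
  "poly_system S D A \<longleftrightarrow> finite A \<and> (\<forall>P\<in>A. set_polynomial S D P)"

text \<open>The empty set is not required to act as the identity.\<close>

definition is_action ::
  "'v set \<Rightarrow> 'x::metric_space set \<Rightarrow> ('v set \<Rightarrow> 'x \<Rightarrow> 'x) \<Rightarrow> bool" where
  "is_action V X T \<longleftrightarrow>
     (\<forall>a\<in>Fpow V. continuous_on X (T a) \<and> T a ` X \<subseteq> X) \<and>
     (\<forall>a\<in>Fpow V. \<forall>b\<in>Fpow V. a \<inter> b = {} \<longrightarrow> (\<forall>x\<in>X. T (a \<union> b) x = T a (T b x)))"

text \<open>
  HOL cannot quantify over types inside a formula, so the type containing the compact
  metric spaces is a parameter; a theorem with \<open>'x\<close> a type variable covers all of them.
\<close>

definition system_of_recurrence ::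
  "'x::metric_space itself \<Rightarrow> 's set \<Rightarrow> nat \<Rightarrow> 's setpoly set \<Rightarrow> bool" where
  "system_of_recurrence _ S D A \<longleftrightarrow>
     (\<forall>(X :: 'x set) T (\<epsilon> :: real) H.
        compact X \<and> is_action (tuples S D) X T \<and> \<epsilon> > 0 \<and> H \<in> Fpow S \<longrightarrow>
        (\<exists>N\<in>Fpow S. N \<inter> H = {} \<and>
          (\<forall>x\<in>X. \<exists>n a. n \<noteq> {} \<and> n \<subseteq> N \<and> a \<subseteq> (\<Union>P\<in>A. poly_map S D P N) \<and>
             (\<forall>P\<in>A. a \<inter> poly_map S D P n = {} \<and>
                dist (T (a \<union> poly_map S D P n) x) (T a x) < \<epsilon>))))"

end

theory Submission
  imports Defs "HOL-Library.Multiset_Order"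
begin

text \<open>
  For a fixed point \<open>x\<close> and a finite cover of \<open>X\<close> by balls of radius \<open>\<epsilon>/2\<close>, the map \<open>a \<mapsto> T\<^sup>a x\<close> colours the
  finite sets \<open>a\<close>, so the theorem follows from the polynomial Hales--Jewett theorem for finite
  colourings. That theorem is proved by PET induction combined with colour focusing. Given a
  system containing the zero polynomial, let \<open>p\<^sub>1\<close> be a nonzero member of least degree. The system of
  all derivatives \<open>p(m \<union> n) - p(m)\<close>, with \<open>p\<close> nonzero and \<open>m\<close> ranging over the subsets of a finite set,
  translated by \<open>p\<^sub>1\<close>, has fewer leading forms in the degree of \<open>p\<^sub>1\<close> and no more in higher degrees.
  By induction it yields a set \<open>g\<close> over which the colouring does not see the derivatives; replacing
  each \<open>n\<close> of a focused family by \<open>n \<union> g\<close> and adding \<open>g\<close> itself adds one colour to the family, until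
  the colours are exhausted.
\<close>

section \<open>Polynomials as sets of monomials\<close>

text \<open>
  In a monomial, \<open>None\<close> stands for the variable and \<open>Some c\<close> for the constant \<open>c\<close>. If \<open>n\<close> contains no
  constant of \<open>p\<close>, then \<open>s\<close> lies in the value of \<open>p\<close> at \<open>n\<close> iff replacing the entries of \<open>s\<close> in \<open>n\<close> by
  the variable gives a monomial of \<open>p\<close>. Taking this preimage as the definition for all \<open>n\<close> makes
  evaluation commute with all Boolean operations.
\<close>

definition pattern :: "'s set \<Rightarrow> 's list \<Rightarrow> 's option list" where
  "pattern n s = map (\<lambda>x. if x \<in> n then None else Some x) s"

definition eval_poly :: "'s option list set \<Rightarrow> 's set \<Rightarrow> 's list set" where
  "eval_poly p n = {s. pattern n s \<in> p}"

text \<open>Demanding an occurrence of the variable encodes the empty constant term.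
  \<open>H\<close> records the constants that an argument has to avoid, and a finite
  \<open>H\<close> leaves only finitely many monomials.\<close>

definition monomials :: "nat \<Rightarrow> 's set \<Rightarrow> 's option list set" where
  "monomials D H = {\<mu>. length \<mu> = D \<and> None \<in> set \<mu> \<and> set \<mu> \<subseteq> insert None (Some ` H)}"

text \<open>This is how a pattern changes when the argument is enlarged by \<open>m\<close>.\<close>

definition absorb :: "'s set \<Rightarrow> 's option list \<Rightarrow> 's option list" where
  "absorb m \<mu> = map (\<lambda>y. if y \<in> Some ` m then None else y) \<mu>"

text \<open>For \<open>n\<close> avoiding \<open>m\<close> and the constants of \<open>p\<close>,
  this represents the increment p(m \<union> n) - p(m) as a polynomial in \<open>n\<close>; the
  condition on \<open>None\<close> removes the part p(m), which does not depend on
  \<open>n\<close>.\<close>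

definition deriv_poly :: "'s set \<Rightarrow> 's option list set \<Rightarrow> 's option list set" where
  "deriv_poly m p = {\<mu>. absorb m \<mu> \<in> p \<and> None \<in> set \<mu>}"

text \<open>Symmetric difference plays the part of subtraction: unlike union it can be undone, and
  evaluation commutes with it.\<close>

definition sdiff :: "'a set \<Rightarrow> 'a set \<Rightarrow> 'a set" where
  "sdiff p q = (p - q) \<union> (q - p)"

lemma sdiff_iff: "x \<in> sdiff p q \<longleftrightarrow> (x \<in> p) \<noteq> (x \<in> q)"
  by (auto simp: sdiff_def)

lemma finite_tuples: "finite H \<Longrightarrow> finite (tuples H D)"
  using finite_lists_length_eq[of H D] unfolding tuples_def by (simp add: conj_commute)

lemma finite_monomials: "finite H \<Longrightarrow> finite (monomials D H)"
  by (rule finite_subset[OF _ finite_lists_length_eq[of "insert None (Some ` H)" D]])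
     (auto simp: monomials_def)

lemma eval_poly_empty [simp]: "eval_poly {} n = {}"
  by (simp add: eval_poly_def)

lemma eval_poly_subset_tuples:
  assumes "p \<subseteq> monomials D H"
  shows "eval_poly p n \<subseteq> tuples (n \<union> H) D"
proof
  fix s assume "s \<in> eval_poly p n"
  then have *: "length (pattern n s) = D" "set (pattern n s) \<subseteq> insert None (Some ` H)"
    using assms by (auto simp: eval_poly_def monomials_def)
  show "s \<in> tuples (n \<union> H) D"
    using * by (auto simp: tuples_def pattern_def split: if_splits)
qed

lemma eval_poly_meets:
  assumes "p \<subseteq> monomials D H" "s \<in> eval_poly p n"
  shows "set s \<inter> n \<noteq> {}"
proof -
  have "None \<in> set (pattern n s)"
    using assms by (auto simp: eval_poly_def monomials_def)
  then show ?thesis by (auto simp: pattern_def split: if_splits)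
qed

section \<open>Evaluation on unions and derivatives\<close>

lemma pattern_Un: "pattern (n \<union> m) s = absorb m (pattern n s)"
  by (auto simp: pattern_def absorb_def)

text \<open>A tuple missing \<open>n\<close> has the same pattern for \<open>m \<union> n\<close> as
  for \<open>m\<close>. A tuple meeting \<open>n\<close> cannot lie in p(m), whose tuples have
  entries in \<open>m \<union> H\<close>, and its pattern for \<open>n\<close> contains the
  variable.\<close>

lemma eval_poly_Un:
  assumes p: "p \<subseteq> monomials D H" and n: "n \<inter> (m \<union> H) = {}"
  shows "eval_poly p (m \<union> n) = eval_poly p m \<union> eval_poly (deriv_poly m p) n"
proof (rule set_eqI)
  fix s
  have 1: "pattern (m \<union> n) s = pattern m s" if "set s \<inter> n = {}"
    using that by (auto simp: pattern_def)
  have 2: "set s \<inter> n = {}" if "s \<in> eval_poly p m"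
    using eval_poly_subset_tuples[OF p, of m] that n unfolding tuples_def by blast
  have 3: "None \<in> set (pattern n s) \<longleftrightarrow> set s \<inter> n \<noteq> {}"
    by (auto simp: pattern_def)
  show "s \<in> eval_poly p (m \<union> n) \<longleftrightarrow> s \<in> eval_poly p m \<union> eval_poly (deriv_poly m p) n"
    using 1 2 3 pattern_Un[of n m s] by (auto simp: eval_poly_def deriv_poly_def Un_commute)
qed

lemma deriv_poly_monomials:
  assumes "p \<subseteq> monomials D H"
  shows "deriv_poly m p \<subseteq> monomials D (H \<union> m)"
proof
  fix \<mu> assume "\<mu> \<in> deriv_poly m p"
  then have *: "None \<in> set \<mu>" "length (absorb m \<mu>) = D"
      "set (absorb m \<mu>) \<subseteq> insert None (Some ` H)"
    using assms by (auto simp: deriv_poly_def monomials_def)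
  have "y \<in> insert None (Some ` (H \<union> m))" if "y \<in> set \<mu>" for y
  proof (cases "y \<in> Some ` m")
    case False
    then have "y \<in> set (absorb m \<mu>)" using that by (force simp: absorb_def)
    then show ?thesis using *(3) by blast
  qed auto
  then show "\<mu> \<in> monomials D (H \<union> m)" using *(1,2) by (auto simp: monomials_def absorb_def)
qed

lemma deriv_poly_empty_arg:
  assumes "p \<subseteq> monomials D H"
  shows "deriv_poly {} p = p"
  using assms by (auto simp: deriv_poly_def absorb_def monomials_def)

section \<open>Colour focusing\<close>

text \<open>The base \<open>a\<close> must avoid all tuples over \<open>n \<union> H\<close>, not
  merely the values at \<open>n\<close>. This condition does not mention the system, so it survives
  a change of system by translation.\<close>

definition monochromatic :: "'s set \<Rightarrow> nat \<Rightarrow> 's option list set set \<Rightarrow> 's set \<Rightarrow> ('s list set \<Rightarrow> nat) \<Rightarrow> bool" where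
  "monochromatic H D A N \<phi> \<longleftrightarrow> (\<exists>n a c. n \<noteq> {} \<and> n \<subseteq> N \<and> a \<subseteq> tuples (N \<union> H) D \<and>
     a \<inter> tuples (n \<union> H) D = {} \<and> (\<forall>p\<in>A. \<phi> (a \<union> eval_poly p n) = c))"

definition hales_jewett :: "'s set \<Rightarrow> 's set \<Rightarrow> nat \<Rightarrow> 's option list set set \<Rightarrow> bool" where
  "hales_jewett S H D A \<longleftrightarrow> (\<forall>k. \<exists>N. finite N \<and> N \<subseteq> S \<and> N \<inter> H = {} \<and>
     (\<forall>\<phi>. (\<forall>b. \<phi> b < k) \<longrightarrow> monochromatic H D A N \<phi>))"

text \<open>Apply the hypothesis to the colouring that first takes the symmetric difference with
  p0(N). On tuples over \<open>n \<union> H\<close> this undoes the translation by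
  \<open>p0\<close>; elsewhere it only changes the base.\<close>

lemma hales_jewett_translate:
  assumes A: "A \<subseteq> Pow (monomials D H)" and p0: "p0 \<subseteq> monomials D H"
    and hales_jewett: "hales_jewett S H D ((\<lambda>q. sdiff q p0) ` A)"
  shows "hales_jewett S H D A"
  unfolding hales_jewett_def
proof
  fix k
  obtain N where N: "finite N" "N \<subseteq> S" "N \<inter> H = {}"
    and mono: "\<And>\<phi>. (\<forall>b. \<phi> b < k) \<Longrightarrow> monochromatic H D ((\<lambda>q. sdiff q p0) ` A) N \<phi>"
    using hales_jewett unfolding hales_jewett_def by metis
  have "monochromatic H D A N \<phi>" if \<phi>: "\<forall>b. \<phi> b < k" for \<phi>
  proof -
    obtain n a c where n: "n \<noteq> {}" "n \<subseteq> N" and a: "a \<subseteq> tuples (N \<union> H) D"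
      and disj: "a \<inter> tuples (n \<union> H) D = {}"
      and c: "\<forall>p\<in>(\<lambda>q. sdiff q p0) ` A. \<phi> (sdiff (a \<union> eval_poly p n) (eval_poly p0 N)) = c"
      using mono[of "\<lambda>b. \<phi> (sdiff b (eval_poly p0 N))"] \<phi> unfolding monochromatic_def by blast
    \<comment> \<open>The part of p0(N) inside p0(n) cancels the translation; the rest is moved into
      the base.\<close>
    define a' where "a' = sdiff a (eval_poly p0 N - eval_poly p0 n)"
    \<comment> \<open>\<open>N\<close> avoids \<open>H\<close>, so among entries from
      \<open>n \<union> H\<close> those in \<open>N\<close> are exactly those in \<open>n\<close>.
      Hence p0(n) and p0(N) agree on these tuples.\<close>
    have pat: "pattern n s = pattern N s" if "s \<in> tuples (n \<union> H) D" for s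
      using that n N by (auto simp: pattern_def tuples_def)
    have eq: "sdiff (a \<union> eval_poly (sdiff q p0) n) (eval_poly p0 N) = a' \<union> eval_poly q n"
      if "q \<in> A" for q
    proof (rule set_eqI)
      fix s
      have sub: "eval_poly q n \<subseteq> tuples (n \<union> H) D" "eval_poly p0 n \<subseteq> tuples (n \<union> H) D"
        using eval_poly_subset_tuples A that p0 by blast+
      have sd: "eval_poly (sdiff q p0) n = sdiff (eval_poly q n) (eval_poly p0 n)"
        by (auto simp: eval_poly_def sdiff_def)
      show "s \<in> sdiff (a \<union> eval_poly (sdiff q p0) n) (eval_poly p0 N) \<longleftrightarrow> s \<in> a' \<union> eval_poly q n"
      proof (cases "s \<in> tuples (n \<union> H) D")
        case True
        then have "s \<in> eval_poly p0 n \<longleftrightarrow> s \<in> eval_poly p0 N"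
          using pat by (simp add: eval_poly_def)
        moreover have "s \<notin> a" using True disj by blast
        ultimately show ?thesis by (auto simp: sd a'_def sdiff_iff)
      next
        case False
        then have "s \<notin> eval_poly q n" "s \<notin> eval_poly p0 n" using sub by blast+
        then show ?thesis by (simp add: sd a'_def sdiff_iff)
      qed
    qed
    have "a' \<subseteq> tuples (N \<union> H) D"
      using a eval_poly_subset_tuples[OF p0, of N] unfolding a'_def sdiff_def by blast
    moreover have "a' \<inter> tuples (n \<union> H) D = {}"
    proof -
      have "s \<notin> a'" if s: "s \<in> tuples (n \<union> H) D" for s
      proof -
        have "s \<in> eval_poly p0 n \<longleftrightarrow> s \<in> eval_poly p0 N" using pat[OF s] by (simp add: eval_poly_def)
        moreover have "s \<notin> a" using disj s by blast
        ultimately show ?thesis by (simp add: a'_def sdiff_iff)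
      qed
      then show ?thesis by blast
    qed
    moreover have "\<forall>q\<in>A. \<phi> (a' \<union> eval_poly q n) = c" using c eq by simp
    ultimately show ?thesis unfolding monochromatic_def using n
      by (intro exI[of _ n] exI[of _ a'] exI[of _ c] conjI)
  qed
  then show "\<exists>N. finite N \<and> N \<subseteq> S \<and> N \<inter> H = {} \<and> (\<forall>\<phi>. (\<forall>b. \<phi> b < k) \<longrightarrow> monochromatic H D A N \<phi>)"
    using N by blast
qed

text \<open>Since \<open>m\<close> may be empty, every nonzero member of \<open>A\<close> with empty
  constant term is among its own derivatives.\<close>

definition derivs :: "'s set \<Rightarrow> 's option list set set \<Rightarrow> 's option list set set" where
  "derivs M A = (\<lambda>(m, p). deriv_poly m p) ` (Pow M \<times> (A - {{}}))"

text \<open>All the sets \<open>n\<close> share the base \<open>a\<close>, which is the value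
  belonging to the zero polynomial; its colour is left open. Avoiding \<open>tuples H D\<close> is
  what allows a further \<open>n\<close>, disjoint from everything used so far, to join the
  family.\<close>

definition focused ::
  "'s set \<Rightarrow> nat \<Rightarrow> 's option list set set \<Rightarrow> 's set \<Rightarrow> ('s list set \<Rightarrow> nat) \<Rightarrow> 's list set \<Rightarrow> nat set \<Rightarrow> bool"
where
  "focused H D A N \<phi> a C \<longleftrightarrow> a \<subseteq> tuples (N \<union> H) D \<and> a \<inter> tuples H D = {} \<and>
     (\<forall>c\<in>C. \<exists>n. n \<noteq> {} \<and> n \<subseteq> N \<and> a \<inter> tuples (n \<union> H) D = {} \<and>
        (\<forall>p\<in>A - {{}}. \<phi> (a \<union> eval_poly p n) = c))"

text \<open>If the base has one of the focused colours, the zero polynomial agrees with the nonzero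
  ones for the corresponding \<open>n\<close>.\<close>

lemma focused_imp_monochromatic:
  assumes "focused H D A N \<phi> a C" "\<phi> a \<in> C"
  shows "monochromatic H D A N \<phi>"
proof -
  obtain n where n: "n \<noteq> {}" "n \<subseteq> N" "a \<inter> tuples (n \<union> H) D = {}"
    "\<And>p. p \<in> A - {{}} \<Longrightarrow> \<phi> (a \<union> eval_poly p n) = \<phi> a"
    using assms unfolding focused_def by metis
  have "\<forall>p\<in>A. \<phi> (a \<union> eval_poly p n) = \<phi> a"
  proof
    fix p assume "p \<in> A"
    then show "\<phi> (a \<union> eval_poly p n) = \<phi> a" using n(4)[of p] by (cases "p = {}") auto
  qed
  moreover have "a \<subseteq> tuples (N \<union> H) D" using assms(1) by (simp add: focused_def)
  ultimately show ?thesis using n(1-3) unfolding monochromatic_def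
    by (intro exI[of _ n] exI[of _ a] exI[of _ "\<phi> a"] conjI)
qed

text \<open>A colouring of \<open>w \<union> b\<close>, with \<open>w\<close> ranging over a finite family, is a colouring of \<open>b\<close> by functions of \<open>w\<close>.\<close>

lemma hales_jewett_uniform:
  assumes "hales_jewett S H D A" "finite \<W>"
  obtains N where "finite N" "N \<subseteq> S" "N \<inter> H = {}"
    "\<And>\<phi>. \<forall>b. \<phi> b < (k::nat) \<Longrightarrow> \<exists>n a. n \<noteq> {} \<and> n \<subseteq> N \<and> a \<subseteq> tuples (N \<union> H) D \<and>
       a \<inter> tuples (n \<union> H) D = {} \<and>
       (\<forall>w\<in>\<W>. \<forall>p\<in>A. \<forall>q\<in>A. \<phi> (w \<union> (a \<union> eval_poly p n)) = \<phi> (w \<union> (a \<union> eval_poly q n)))"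
proof -
  let ?F = "\<W> \<rightarrow>\<^sub>E {..<k}"
  have "finite ?F" using assms(2) by (simp add: finite_PiE)
  then obtain h where h: "bij_betw h ?F {0..<card ?F}" using ex_bij_betw_finite_nat by blast
  obtain N where N: "finite N" "N \<subseteq> S" "N \<inter> H = {}"
    and mono: "\<And>\<phi>. (\<forall>b. \<phi> b < card ?F) \<Longrightarrow> monochromatic H D A N \<phi>"
    using assms(1) unfolding hales_jewett_def by metis
  show thesis
  proof (rule that[OF N])
    fix \<phi> :: "'a list set \<Rightarrow> nat" assume \<phi>: "\<forall>b. \<phi> b < k"
    let ?g = "\<lambda>b. restrict (\<lambda>w. \<phi> (w \<union> b)) \<W>"
    have g: "?g b \<in> ?F" for b using \<phi> by auto
    have "h (?g b) < card ?F" for b using bij_betwE[OF h] g[of b] by fastforce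
    then have "monochromatic H D A N (\<lambda>b. h (?g b))" using mono[of "\<lambda>b. h (?g b)"] by blast
    then obtain n a c where n: "n \<noteq> {}" "n \<subseteq> N" "a \<subseteq> tuples (N \<union> H) D" "a \<inter> tuples (n \<union> H) D = {}"
      and c: "\<forall>p\<in>A. h (?g (a \<union> eval_poly p n)) = c"
      unfolding monochromatic_def by blast
    have "?g (a \<union> eval_poly p n) = ?g (a \<union> eval_poly q n)" if "p \<in> A" "q \<in> A" for p q
      by (rule inj_onD[OF bij_betw_imp_inj_on[OF h]]) (use c that g in auto)
    then have "\<forall>w\<in>\<W>. \<forall>p\<in>A. \<forall>q\<in>A. \<phi> (w \<union> (a \<union> eval_poly p n)) = \<phi> (w \<union> (a \<union> eval_poly q n))"
      by (metis (no_types, lifting) restrict_apply')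
    with n show "\<exists>n a. n \<noteq> {} \<and> n \<subseteq> N \<and> a \<subseteq> tuples (N \<union> H) D \<and>
       a \<inter> tuples (n \<union> H) D = {} \<and>
       (\<forall>w\<in>\<W>. \<forall>p\<in>A. \<forall>q\<in>A. \<phi> (w \<union> (a \<union> eval_poly p n)) = \<phi> (w \<union> (a \<union> eval_poly q n)))"
      by blast
  qed
qed

text \<open>Induction on the number \<open>r\<close> of focused colours. A set \<open>g\<close>
  disjoint from the old ground set \<open>M\<close> is found on which the derivatives are
  indistinguishable; it extends every old focused set and also yields a new one.\<close>

lemma colour_focusing:
  assumes H: "finite H" and A: "A \<subseteq> Pow (monomials D H)" and ne: "A - {{}} \<noteq> {}"
    and hales_jewett: "\<And>M. finite M \<Longrightarrow> M \<inter> H = {} \<Longrightarrow> hales_jewett S (H \<union> M) D (derivs M A)"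
  shows "\<exists>M. finite M \<and> M \<subseteq> S \<and> M \<inter> H = {} \<and> (\<forall>\<phi>. (\<forall>b. \<phi> b < k) \<longrightarrow>
    monochromatic H D A M \<phi> \<or> (\<exists>a C. C \<subseteq> {..<k} \<and> card C = r \<and> focused H D A M \<phi> a C))"
proof (induction r)
  case 0
  have "focused H D A {} \<phi> {} {}" for \<phi> by (simp add: focused_def)
  then show ?case by (intro exI[of _ "{}"]) fastforce
next
  case (Suc r)
  then obtain M where M: "finite M" "M \<subseteq> S" "M \<inter> H = {}"
    and foc: "\<And>\<phi>. (\<forall>b. \<phi> b < k) \<Longrightarrow> monochromatic H D A M \<phi> \<or>
      (\<exists>a C. C \<subseteq> {..<k} \<and> card C = r \<and> focused H D A M \<phi> a C)"
    by metis
  \<comment> \<open>These are the possible configurations over the old ground set; there are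
    finitely many, so one \<open>g\<close> can serve all of them.\<close>
  let ?W = "Pow (tuples (M \<union> H) D)"
  have "finite ?W" using M H finite_tuples by blast
  with hales_jewett[OF M(1,3)] obtain N where N: "finite N" "N \<subseteq> S" "N \<inter> (H \<union> M) = {}"
    and line: "\<And>\<phi>. \<forall>b. \<phi> b < k \<Longrightarrow> \<exists>n a. n \<noteq> {} \<and> n \<subseteq> N \<and> a \<subseteq> tuples (N \<union> (H \<union> M)) D \<and>
       a \<inter> tuples (n \<union> (H \<union> M)) D = {} \<and>
       (\<forall>w\<in>?W. \<forall>p\<in>derivs M A. \<forall>q\<in>derivs M A.
          \<phi> (w \<union> (a \<union> eval_poly p n)) = \<phi> (w \<union> (a \<union> eval_poly q n)))"
    by (rule hales_jewett_uniform[where k = k]) (fact | blast)+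
  obtain p1 where p1: "p1 \<in> A" "p1 \<noteq> {}" using ne by auto
  have in_derivs: "deriv_poly m p \<in> derivs M A" if "m \<subseteq> M" "p \<in> A - {{}}" for m p
    using that by (auto simp: derivs_def)
  have self: "p \<in> derivs M A" if "p \<in> A - {{}}" for p
    using in_derivs[of "{}" p] deriv_poly_empty_arg[of p D H] that A by auto
  have "monochromatic H D A (M \<union> N) \<phi> \<or> (\<exists>a C. C \<subseteq> {..<k} \<and> card C = Suc r \<and> focused H D A (M \<union> N) \<phi> a C)"
    if \<phi>: "\<forall>b. \<phi> b < k" for \<phi>
  proof -
    obtain g a where g: "g \<noteq> {}" "g \<subseteq> N" and a: "a \<subseteq> tuples (N \<union> (H \<union> M)) D"
       "a \<inter> tuples (g \<union> (H \<union> M)) D = {}"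
       and inv: "\<And>w p q. w \<subseteq> tuples (M \<union> H) D \<Longrightarrow> p \<in> derivs M A \<Longrightarrow> q \<in> derivs M A \<Longrightarrow>
          \<phi> (w \<union> (a \<union> eval_poly p g)) = \<phi> (w \<union> (a \<union> eval_poly q g))"
      using line[OF \<phi>] by (metis PowI)
    \<comment> \<open>The colouring seen from the old ground set once \<open>g\<close> and
      \<open>a\<close> are fixed. Any other derivative in place of \<open>p1\<close> would give the
      same colours.\<close>
    define \<phi>' where "\<phi>' w = \<phi> (w \<union> (a \<union> eval_poly p1 g))" for w
    have inv': "\<phi> (w \<union> (a \<union> eval_poly p g)) = \<phi>' w" if "w \<subseteq> tuples (M \<union> H) D" "p \<in> derivs M A" for w p
      using inv[OF that, of p1] self p1 by (auto simp: \<phi>'_def)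
    have ev: "eval_poly p n \<subseteq> tuples (n \<union> H) D" if "p \<in> A" for p n
      using that A eval_poly_subset_tuples by blast
    have tuples_mono: "tuples K D \<subseteq> tuples L D" if "K \<subseteq> L" for K L :: "'a set"
      using that by (auto simp: tuples_def)
    have a_tup: "a \<inter> tuples (n \<union> H) D = {}" if "n \<subseteq> M \<union> g" for n
      using a(2) tuples_mono[of "n \<union> H" "g \<union> (H \<union> M)"] that by blast
    \<comment> \<open>The set \<open>a \<union> eval_poly p1 g\<close> joins the base. Every tuple
      of \<open>eval_poly p1 g\<close> meets \<open>g\<close>, hence is no tuple over
      \<open>n \<union> H\<close>.\<close>
    have lift: "monochromatic H D A (M \<union> N) \<phi>" if "monochromatic H D A M \<phi>'"
    proof -
      obtain n a' c where n: "n \<noteq> {}" "n \<subseteq> M" and a': "a' \<subseteq> tuples (M \<union> H) D"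
        "a' \<inter> tuples (n \<union> H) D = {}" and c: "\<And>p. p \<in> A \<Longrightarrow> \<phi>' (a' \<union> eval_poly p n) = c"
        using \<open>monochromatic H D A M \<phi>'\<close> unfolding monochromatic_def by blast
      let ?a = "a' \<union> a \<union> eval_poly p1 g"
      have "?a \<subseteq> tuples (M \<union> N \<union> H) D"
        using a' a(1) ev[OF p1(1), of g] g(2) by (fastforce simp: tuples_def)
      moreover have "eval_poly p1 g \<inter> tuples (n \<union> H) D = {}"
        using eval_poly_meets[of p1 D H _ g] p1 A g(2) N(3) n(2) by (fastforce simp: tuples_def)
      moreover have "\<phi> (?a \<union> eval_poly p n) = c" if "p \<in> A" for p
        using c[OF that] by (simp add: \<phi>'_def Un_ac)
      ultimately show ?thesis
        unfolding monochromatic_def using n a'(2) a_tup[of n]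
        by (intro exI[of _ n] exI[of _ ?a] exI[of _ c]) blast
    qed
    consider "monochromatic H D A M \<phi>'"
      | a' C where "C \<subseteq> {..<k}" "card C = r" "focused H D A M \<phi>' a' C"
      using foc[of \<phi>'] \<phi> by (auto simp: \<phi>'_def)
    then show ?thesis
    proof cases
      case 1
      then show ?thesis using lift by blast
    next
      case 2
      show ?thesis
      \<comment> \<open>Either the focus repeats a colour, which already gives a monochromatic
        configuration, or its colour is new.\<close>
      proof (cases "\<phi>' a' \<in> C")
        case True
        then show ?thesis using lift focused_imp_monochromatic 2 by blast
      next
        case False
        have a': "a' \<subseteq> tuples (M \<union> H) D" "a' \<inter> tuples H D = {}"
          using 2(3) by (auto simp: focused_def)
        \<comment> \<open>Entries of tuples in \<open>a'\<close> lie in \<open>M \<union> H\<close>,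
          which is disjoint from \<open>g\<close>.\<close>
        have inter: "a' \<inter> tuples (n \<union> g \<union> H) D = {}" if "a' \<inter> tuples (n \<union> H) D = {}" for n
          using that a'(1) g(2) N(3) by (fastforce simp: tuples_def)
        have "\<exists>n. n \<noteq> {} \<and> n \<subseteq> M \<union> N \<and> (a' \<union> a) \<inter> tuples (n \<union> H) D = {} \<and>
            (\<forall>p\<in>A - {{}}. \<phi> (a' \<union> a \<union> eval_poly p n) = c)" if "c \<in> insert (\<phi>' a') C" for c
        proof (cases "c \<in> C")
          case True
          then obtain n where n: "n \<noteq> {}" "n \<subseteq> M" "a' \<inter> tuples (n \<union> H) D = {}"
            "\<And>p. p \<in> A - {{}} \<Longrightarrow> \<phi>' (a' \<union> eval_poly p n) = c"
            using 2(3) unfolding focused_def by metis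
          have "\<forall>p\<in>A - {{}}. \<phi> (a' \<union> a \<union> eval_poly p (n \<union> g)) = c"
          proof
            fix p assume p: "p \<in> A - {{}}"
            \<comment> \<open>An old colour is kept: the increment from \<open>n\<close> to
              \<open>n \<union> g\<close> is a derivative evaluated at \<open>g\<close>, which the
              colouring does not see.\<close>
            have "eval_poly p (n \<union> g) = eval_poly p n \<union> eval_poly (deriv_poly n p) g"
              by (rule eval_poly_Un[of p D H]) (use p A g N n in auto)
            then have "a' \<union> a \<union> eval_poly p (n \<union> g) =
                a' \<union> eval_poly p n \<union> (a \<union> eval_poly (deriv_poly n p) g)" by blast
            moreover have "a' \<union> eval_poly p n \<subseteq> tuples (M \<union> H) D"
              using a'(1) ev[of p n] p n(2) tuples_mono[of "n \<union> H" "M \<union> H"] by blast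
            ultimately show "\<phi> (a' \<union> a \<union> eval_poly p (n \<union> g)) = c"
              using inv' in_derivs[OF n(2) p] n(4)[OF p] by simp
          qed
          moreover have "(a' \<union> a) \<inter> tuples (n \<union> g \<union> H) D = {}"
            using n(2) inter[OF n(3)] a_tup[of "n \<union> g"] by blast
          moreover have "n \<union> g \<noteq> {}" "n \<union> g \<subseteq> M \<union> N" using n(1,2) g(2) by auto
          ultimately show ?thesis by (intro exI[of _ "n \<union> g"] conjI)
        next
          case False
          then have c: "c = \<phi>' a'" using that by blast
          \<comment> \<open>The new colour comes from \<open>g\<close> alone, each \<open>p\<close>
            being its own derivative along the empty set.\<close>
          have "\<forall>p\<in>A - {{}}. \<phi> (a' \<union> a \<union> eval_poly p g) = c"
            using inv'[OF a'(1) self] c by (simp add: Un_ac)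
          moreover have "(a' \<union> a) \<inter> tuples (g \<union> H) D = {}"
            using inter[of "{}"] a'(2) a_tup[of g] by auto
          moreover have "g \<subseteq> M \<union> N" using g(2) by auto
          ultimately show ?thesis using g(1) by (intro exI[of _ g] conjI)
        qed
        moreover have "a' \<union> a \<subseteq> tuples (M \<union> N \<union> H) D"
          using a(1) a'(1) by (fastforce simp: tuples_def)
        moreover have "(a' \<union> a) \<inter> tuples H D = {}" using a'(2) a_tup[of "{}"] by auto
        ultimately have "focused H D A (M \<union> N) \<phi> (a' \<union> a) (insert (\<phi>' a') C)"
          unfolding focused_def by blast
        moreover have "insert (\<phi>' a') C \<subseteq> {..<k}" using 2(1) \<phi> by (simp add: \<phi>'_def)
        moreover have "card (insert (\<phi>' a') C) = Suc r"
          using False 2(1,2) finite_subset[OF 2(1)] by simp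
        ultimately show ?thesis by blast
      qed
    qed
  qed
  then show ?case using M N by (intro exI[of _ "M \<union> N"]) auto
qed

section \<open>PET induction\<close>

abbreviation deg :: "'s option list \<Rightarrow> nat" where
  "deg \<mu> \<equiv> count_list \<mu> None"

text \<open>As a relation, it assigns no degree to the zero polynomial.\<close>

definition has_degree :: "'s option list set \<Rightarrow> nat \<Rightarrow> bool" where
  "has_degree p k \<longleftrightarrow> k \<in> deg ` p \<and> (\<forall>\<mu>\<in>p. deg \<mu> \<le> k)"

definition homogeneous :: "nat \<Rightarrow> 's option list set \<Rightarrow> 's option list set" where
  "homogeneous k p = {\<mu> \<in> p. deg \<mu> = k}"

text \<open>Nonzero polynomials count as equivalent when degree and leading form agree; these are
  the classes of degree \<open>k\<close>.\<close>

definition leading :: "'s option list set set \<Rightarrow> nat \<Rightarrow> 's option list set set" where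
  "leading A k = homogeneous k ` {p \<in> A. has_degree p k}"

text \<open>The multiset order compares two weights at the highest degree where they differ, and it
  is well-founded. Monomials of length \<open>D\<close> have degree at most
  \<open>D\<close>.\<close>

definition weight :: "nat \<Rightarrow> 's option list set set \<Rightarrow> nat multiset" where
  "weight D A = (\<Sum>k\<le>D. replicate_mset (card (leading A k)) k)"

lemma has_degree_unique: "has_degree p j \<Longrightarrow> has_degree p k \<Longrightarrow> j = k"
  unfolding has_degree_def by (metis imageE le_antisym)

lemma has_degree_exists:
  assumes "finite p" "p \<noteq> {}"
  obtains k where "has_degree p k"
proof
  show "has_degree p (Max (deg ` p))" using assms by (auto simp: has_degree_def)
qed

lemma deg_absorb: "deg \<mu> \<le> deg (absorb m \<mu>)"
  by (induction \<mu>) (auto simp: absorb_def)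

text \<open>Absorption only turns constants into variables, so any actual change raises the
  degree.\<close>

lemma deg_absorb_eqD: "deg (absorb m \<mu>) = deg \<mu> \<Longrightarrow> absorb m \<mu> = \<mu>"
proof (induction \<mu>)
  case (Cons y \<mu>)
  then show ?case using deg_absorb[of \<mu> m] by (auto simp: absorb_def split: if_splits)
qed (simp add: absorb_def)

lemma absorb_monomial:
  assumes "\<mu> \<in> monomials D H" "m \<inter> H = {}"
  shows "absorb m \<mu> = \<mu>"
  unfolding absorb_def by (rule map_idI) (use assms in \<open>force simp: monomials_def\<close>)

text \<open>Monomials of \<open>p\<close> have no constants in \<open>m\<close>, so absorption fixes
  them and they survive in the derivative. A monomial of the derivative that absorption changes has
  its degree raised to at most \<open>k\<close>, so it lies below the top degree.\<close>

lemma
  assumes p: "p \<subseteq> monomials D H" and m: "m \<inter> H = {}" and k: "has_degree p k"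
  shows deg_deriv_poly_le: "\<And>\<mu>. \<mu> \<in> deriv_poly m p \<Longrightarrow> deg \<mu> \<le> k"
    and homogeneous_deriv_poly: "homogeneous k (deriv_poly m p) = homogeneous k p"
proof -
  have le: "deg \<mu> \<le> deg (absorb m \<mu>)" "deg (absorb m \<mu>) \<le> k" if "\<mu> \<in> deriv_poly m p" for \<mu>
    using that k deg_absorb[of \<mu> m] by (auto simp: deriv_poly_def has_degree_def)
  show "\<And>\<mu>. \<mu> \<in> deriv_poly m p \<Longrightarrow> deg \<mu> \<le> k" by (rule le_trans[OF le])
  have "\<mu> \<in> p" if "\<mu> \<in> deriv_poly m p" "deg \<mu> = k" for \<mu>
  proof -
    have "absorb m \<mu> = \<mu>"
      by (rule deg_absorb_eqD) (use le[OF that(1)] that(2) in linarith)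
    then show ?thesis using that(1) by (simp add: deriv_poly_def)
  qed
  moreover have "\<mu> \<in> deriv_poly m p" if "\<mu> \<in> p" for \<mu>
  proof -
    have "\<mu> \<in> monomials D H" using that p by blast
    then show ?thesis
      using absorb_monomial[of \<mu> D H m] m that by (simp add: deriv_poly_def monomials_def)
  qed
  ultimately show "homogeneous k (deriv_poly m p) = homogeneous k p"
    unfolding homogeneous_def by blast
qed

section \<open>Decrease of the weight\<close>

lemma count_weight: "count (weight D A) k = (if k \<le> D then card (leading A k) else 0)"
  unfolding weight_def count_sum by (simp add: sum.delta)

text \<open>Any degree in which \<open>B\<close> has more classes lies below \<open>e\<close>, where
  the drop outweighs it.\<close>

lemma weight_less:
  assumes "e \<le> D" "card (leading B e) < card (leading A e)"
    and "\<And>k. e < k \<Longrightarrow> card (leading B k) \<le> card (leading A k)"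
  shows "weight D B < weight D A"
  unfolding less_multiset\<^sub>H\<^sub>O
proof
  have e: "count (weight D B) e < count (weight D A) e"
    using assms(1,2) by (simp add: count_weight)
  then show "weight D B \<noteq> weight D A" by auto
  show "\<forall>y. count (weight D A) y < count (weight D B) y \<longrightarrow>
      (\<exists>x>y. count (weight D B) x < count (weight D A) x)"
  proof (intro allI impI)
    fix y assume y: "count (weight D A) y < count (weight D B) y"
    then have "\<not> e < y" using assms(3)[of y] by (auto simp: count_weight split: if_splits)
    moreover have "y \<noteq> e" using e y by auto
    ultimately show "\<exists>x>y. count (weight D B) x < count (weight D A) x"
      using e by (intro exI[of _ e]) simp
  qed
qed

text \<open>Above degree \<open>e\<close>, neither the derivative nor the translation changes a
  leading form. In degree \<open>e\<close>, each form is translated by that of \<open>p1\<close>,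
  and the class of \<open>p1\<close> itself falls to lower degree. Thus only degrees below
  \<open>e\<close> can gain classes.\<close>

lemma weight_derivs_less:
  assumes H: "finite H" and A: "A \<subseteq> Pow (monomials D H)" and M: "M \<inter> H = {}"
    and p1: "p1 \<in> A" "has_degree p1 e"
    and min: "\<And>p k. p \<in> A \<Longrightarrow> has_degree p k \<Longrightarrow> e \<le> k"
  shows "weight D ((\<lambda>q. sdiff q p1) ` derivs M A) < weight D A" 
proof -
  define B where "B = (\<lambda>q. sdiff q p1) ` derivs M A"
  have finA: "finite A" using A H finite_monomials finite_subset by blast
  then have finL: "finite (leading A k)" for k by (simp add: leading_def)
  have fin: "finite p" if "p \<in> A" for p using A H finite_monomials finite_subset that by blast
  \<comment> \<open>The first alternative comes from a \<open>p\<close> of degree above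
    \<open>e\<close>, the second from degree \<open>e\<close>, where cancellation of the leading
    forms makes \<open>j\<close> smaller than \<open>e\<close>.\<close>
  have key: "(e < j \<and> homogeneous j q \<in> leading A j) \<or>
      (j \<le> e \<and> (j = e \<longrightarrow> homogeneous j q \<in> (\<lambda>l. sdiff l (homogeneous e p1)) ` (leading A e - {homogeneous e p1})))"
    if q: "q \<in> B" "has_degree q j" for q j
  proof -
    obtain m p where p: "m \<subseteq> M" "p \<in> A" "p \<noteq> {}" and q_eq: "q = sdiff (deriv_poly m p) p1"
      using q(1) by (auto simp: B_def derivs_def)
    obtain k where k: "has_degree p k" using has_degree_exists fin p by blast
    have pH: "p \<subseteq> monomials D H" and mH: "m \<inter> H = {}" using p A M by auto
    note d = deg_deriv_poly_le[OF pH mH k] homogeneous_deriv_poly[OF pH mH k]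
    have ek: "e \<le> k" using min p k by blast
    have le1: "deg \<mu> \<le> e" if "\<mu> \<in> p1" for \<mu> using p1(2) that by (auto simp: has_degree_def)
    have hom: "homogeneous k q = sdiff (homogeneous k p) (homogeneous k p1)"
      using d(2) unfolding q_eq by (auto simp: homogeneous_def sdiff_def)
    have le: "deg \<mu> \<le> k" if "\<mu> \<in> q" for \<mu>
      using that d(1) le1 ek by (force simp: q_eq sdiff_def)
    show ?thesis
    proof (cases "e = k")
      case False
      then have "homogeneous k p1 = {}" using le1 ek by (force simp: homogeneous_def)
      then have hk: "homogeneous k q = homogeneous k p" using hom by (simp add: sdiff_def)
      have "k \<in> deg ` q"
      proof -
        obtain \<mu> where "\<mu> \<in> p" "deg \<mu> = k" using k by (auto simp: has_degree_def)
        then have "\<mu> \<in> homogeneous k q" unfolding hk by (simp add: homogeneous_def)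
        then show ?thesis by (auto simp: homogeneous_def)
      qed
      then have "has_degree q k" using le by (auto simp: has_degree_def)
      then have "j = k" using has_degree_unique q(2) by blast
      then show ?thesis using hk False ek p k by (auto simp: leading_def)
    next
      case True
      have "j \<le> e" using q(2) le True by (auto simp: has_degree_def)
      moreover have "homogeneous e p \<noteq> homogeneous e p1" if "j = e"
      proof
        assume "homogeneous e p = homogeneous e p1"
        then have "homogeneous e q = {}" using hom True by (simp add: sdiff_def)
        then show False using q(2) that by (auto simp: has_degree_def homogeneous_def)
      qed
      moreover have "homogeneous e p \<in> leading A e" using p k True by (auto simp: leading_def)
      ultimately show ?thesis using hom True by blast
    qed
  qed
  have "weight D B < weight D A"
  proof (rule weight_less)
    obtain \<mu> where "\<mu> \<in> p1" "deg \<mu> = e" using p1 by (auto simp: has_degree_def)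
    then show "e \<le> D" using A p1(1) count_le_length[of \<mu> None] by (auto simp: monomials_def)
  next
    fix k assume "e < k"
    have "leading B k \<subseteq> leading A k"
    proof
      fix l assume "l \<in> leading B k"
      then obtain q where "q \<in> B" "has_degree q k" "l = homogeneous k q" by (auto simp: leading_def)
      with key[of q k] \<open>e < k\<close> show "l \<in> leading A k" by auto
    qed
    then show "card (leading B k) \<le> card (leading A k)" by (rule card_mono[OF finL])
  next
    have "leading B e \<subseteq> (\<lambda>l. sdiff l (homogeneous e p1)) ` (leading A e - {homogeneous e p1})"
    proof
      fix l assume "l \<in> leading B e"
      then obtain q where "q \<in> B" "has_degree q e" "l = homogeneous e q" by (auto simp: leading_def)
      with key[of q e] show "l \<in> (\<lambda>l. sdiff l (homogeneous e p1)) ` (leading A e - {homogeneous e p1})"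
        by blast
    qed
    then have "card (leading B e) \<le> card (leading A e - {homogeneous e p1})"
      using finL by (meson card_image_le card_mono finite_Diff finite_imageI le_trans)
    also have "\<dots> < card (leading A e)"
      using finL p1 by (intro psubset_card_mono) (auto simp: leading_def)
    finally show "card (leading B e) < card (leading A e)" .
  qed
  then show ?thesis by (simp only: B_def)
qed

theorem polynomial_hales_jewett:
  assumes S: "infinite S" and "finite H" "A \<subseteq> Pow (monomials D H)" "{} \<in> A"
  shows "hales_jewett S H D A"
  using assms(2-)
proof (induction "weight D A" arbitrary: A H rule: less_induct)
  case (less A H)
  show ?case
  proof (cases "A = {{}}")
    case True
    obtain x where x: "x \<in> S" "x \<notin> H" using S less.prems(1) by (metis finite_subset subsetI)
    have "monochromatic H D A {x} \<phi>" for \<phi>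
      unfolding monochromatic_def True by (intro exI[of _ "{x}"] exI[of _ "{}"]) auto
    then show ?thesis unfolding hales_jewett_def using x by (intro allI exI[of _ "{x}"]) auto
  next
    case False
    then obtain p0 where p0: "p0 \<in> A" "p0 \<noteq> {}" using less.prems(3) by blast
    have fin: "finite p" if "p \<in> A" for p
      using less.prems(1,2) finite_monomials finite_subset that by blast
    define e where "e = (LEAST k. \<exists>p\<in>A. has_degree p k)"
    have "\<exists>k. \<exists>p\<in>A. has_degree p k" using has_degree_exists[OF fin[OF p0(1)] p0(2)] p0(1) by metis
    then have "\<exists>p\<in>A. has_degree p e" unfolding e_def by (rule LeastI_ex)
    then obtain p1 where p1: "p1 \<in> A" "has_degree p1 e" by blast
    have min: "e \<le> k" if "p \<in> A" "has_degree p k" for p k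
      unfolding e_def using that by (blast intro: Least_le)
    have p1_ne: "p1 \<noteq> {}" using p1(2) by (auto simp: has_degree_def)
    \<comment> \<open>The derivatives have constants in \<open>H \<union> M\<close>, which is why
      the induction lets \<open>H\<close> vary.\<close>
    have step: "hales_jewett S (H \<union> M) D (derivs M A)" if M: "finite M" "M \<inter> H = {}" for M
    proof (rule hales_jewett_translate)
      have mono: "monomials D (H \<union> m) \<subseteq> monomials D (H \<union> M)" if "m \<subseteq> M" for m
        using that by (auto simp: monomials_def)
      show sub: "derivs M A \<subseteq> Pow (monomials D (H \<union> M))"
      proof -
        have "deriv_poly m p \<subseteq> monomials D (H \<union> M)" if "m \<subseteq> M" "p \<in> A" for m p
          using deriv_poly_monomials[of p D H m] mono[OF that(1)] that less.prems(2) by blast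
        then show ?thesis by (auto simp: derivs_def)
      qed
      show p1M: "p1 \<subseteq> monomials D (H \<union> M)"
        using p1(1) less.prems(2) mono[of "{}"] by auto
      \<comment> \<open>Since \<open>p1\<close> is its own derivative along the empty set, the
        translated system contains the zero polynomial, as the induction hypothesis
        requires.\<close>
      have "deriv_poly {} p1 \<in> derivs M A" using p1(1) p1_ne by (auto simp: derivs_def)
      then have "p1 \<in> derivs M A"
        using deriv_poly_empty_arg[of p1 D H] p1(1) less.prems(2) by auto
      then have "{} \<in> (\<lambda>q. sdiff q p1) ` derivs M A" by (force simp: sdiff_def)
      moreover have "(\<lambda>q. sdiff q p1) ` derivs M A \<subseteq> Pow (monomials D (H \<union> M))"
        using sub p1M by (auto simp: sdiff_def)
      moreover have "weight D ((\<lambda>q. sdiff q p1) ` derivs M A) < weight D A"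
        by (rule weight_derivs_less[OF less.prems(1,2) M(2) p1 min])
      moreover have "finite (H \<union> M)" using M(1) less.prems(1) by simp
      ultimately show "hales_jewett S (H \<union> M) D ((\<lambda>q. sdiff q p1) ` derivs M A)"
        using less.hyps by simp
    qed
    have ne: "A - {{}} \<noteq> {}" using p0 by blast
    have "\<exists>N. finite N \<and> N \<subseteq> S \<and> N \<inter> H = {} \<and>
        (\<forall>\<phi>. (\<forall>b. \<phi> b < k) \<longrightarrow> monochromatic H D A N \<phi>)" for k
    proof -
      obtain N where N: "finite N" "N \<subseteq> S" "N \<inter> H = {}"
        and foc: "\<And>\<phi>. \<forall>b. \<phi> b < k \<Longrightarrow> monochromatic H D A N \<phi> \<or>
          (\<exists>a C. C \<subseteq> {..<k} \<and> card C = k \<and> focused H D A N \<phi> a C)"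
        using colour_focusing[OF less.prems(1,2) ne step, where k = k and r = k] by blast
      have "monochromatic H D A N \<phi>" if \<phi>: "\<forall>b. \<phi> b < k" for \<phi>
      proof -
        have "monochromatic H D A N \<phi>" if "C \<subseteq> {..<k}" "card C = k" "focused H D A N \<phi> a C" for a C
        proof -
          \<comment> \<open>With \<open>k\<close> focused colours no colour is left, so that of the
            base is among them.\<close>
          have "C = {..<k}" using that(1,2) by (intro card_subset_eq) auto
          then show ?thesis using focused_imp_monochromatic[OF that(3)] \<phi> by blast
        qed
        then show ?thesis using foc[OF \<phi>] by blast
      qed
      then show ?thesis using N by blast
    qed
    then show ?thesis unfolding hales_jewett_def by blast
  qed
qed

section \<open>Recurrence\<close>

definition monomials_of :: "nat \<Rightarrow> 's setpoly \<Rightarrow> 's option list set" where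
  "monomials_of D P = {\<mu>. length \<mu> = D \<and>
     (\<exists>c \<in> P {i. i < D \<and> \<mu> ! i = None}. nths \<mu> {i. i < D \<and> \<mu> ! i \<noteq> None} = map Some c)}"

definition support :: "nat \<Rightarrow> 's setpoly \<Rightarrow> 's set" where
  "support D P = (\<Union>\<alpha>\<in>Pow {..<D}. \<Union>c\<in>P \<alpha>. set c)"

lemma finite_support:
  assumes "set_polynomial S D P"
  shows "finite (support D P)" "support D P \<subseteq> S"
proof -
  have P: "finite (P \<alpha>)" "P \<alpha> \<subseteq> tuples S (card ({..<D} - \<alpha>))" if "\<alpha> \<in> Pow {..<D}" for \<alpha>
    using assms that by (simp_all add: set_polynomial_def Fpow_def)
  show "finite (support D P)" unfolding support_def using P(1) by (intro finite_UN_I) simp_all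
  show "support D P \<subseteq> S" unfolding support_def using P(2) unfolding tuples_def by blast
qed

lemma set_coefficient_subset_support: "c \<in> P \<alpha> \<Longrightarrow> \<alpha> \<subseteq> {..<D} \<Longrightarrow> set c \<subseteq> support D P"
  unfolding support_def by blast

lemma monomials_of_monomials:
  assumes P: "P {} = {}"
  shows "monomials_of D P \<subseteq> monomials D (support D P)"
proof
  fix \<mu> assume "\<mu> \<in> monomials_of D P"
  then obtain c where \<mu>: "length \<mu> = D" and c: "c \<in> P {i. i < D \<and> \<mu> ! i = None}"
    "nths \<mu> {i. i < D \<and> \<mu> ! i \<noteq> None} = map Some c"
    by (auto simp: monomials_of_def)
  have "{i. i < D \<and> \<mu> ! i = None} \<noteq> {}" using c(1) P by (metis empty_iff)
  then have "None \<in> set \<mu>" using \<mu> by (auto simp: in_set_conv_nth)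
  moreover have "y \<in> insert None (Some ` support D P)" if y: "y \<in> set \<mu>" for y
  proof (cases "y = None")
    case False
    obtain i where "i < length \<mu>" "y = \<mu> ! i" using y by (metis in_set_conv_nth)
    then have "y \<in> set (nths \<mu> {i. i < D \<and> \<mu> ! i \<noteq> None})"
      using False \<mu> by (auto simp: set_nths intro!: exI[of _ i])
    then have "y \<in> Some ` set c" using c(2) by simp
    moreover have "set c \<subseteq> support D P" by (rule set_coefficient_subset_support[where P = P, OF c(1)]) auto
    ultimately show ?thesis by blast
  qed simp
  ultimately show "\<mu> \<in> monomials D (support D P)" using \<mu> by (auto simp: monomials_def)
qed

lemma nths_pattern:
  assumes "length s = D"
  shows "nths (pattern n s) {i. i < D \<and> pattern n s ! i \<noteq> None} = map Some (nths s {i. i < D \<and> s ! i \<notin> n})"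
proof -
  have "{i. i < D \<and> pattern n s ! i \<noteq> None} = {i. i < D \<and> s ! i \<notin> n}"
    using assms by (auto simp: pattern_def)
  moreover have "map (\<lambda>x. if x \<in> n then None else Some x) (nths s {i. i < D \<and> s ! i \<notin> n}) =
      map Some (nths s {i. i < D \<and> s ! i \<notin> n})"
    by (rule map_cong) (auto simp: set_nths)
  ultimately show ?thesis by (simp add: pattern_def nths_map)
qed

text \<open>Entries of \<open>s\<close> outside the positions \<open>\<alpha>\<close> are constants
  of \<open>P\<close>, hence not in \<open>n\<close>. So \<open>\<alpha>\<close> must be the set of
  positions with entries in \<open>n\<close>, and the union over \<open>\<alpha>\<close> reduces to
  a single condition on the pattern of \<open>s\<close>.\<close>

lemma poly_map_eq_eval_poly:
  assumes P: "set_polynomial S D P" and n: "n \<subseteq> S" "n \<inter> support D P = {}"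
  shows "poly_map S D P n = eval_poly (monomials_of D P) n"
proof (rule set_eqI)
  fix s :: "'a list"
  let ?\<alpha> = "{i. i < D \<and> s ! i \<in> n}"
  have compl: "{..<D} - ?\<alpha> = {i. i < D \<and> s ! i \<notin> n}" by auto
  have eval: "s \<in> eval_poly (monomials_of D P) n \<longleftrightarrow> length s = D \<and> nths s ({..<D} - ?\<alpha>) \<in> P ?\<alpha>"
  proof (cases "length s = D")
    case True
    have "{i. i < D \<and> pattern n s ! i = None} = ?\<alpha>" using True by (auto simp: pattern_def split: if_splits)
    then have "s \<in> eval_poly (monomials_of D P) n \<longleftrightarrow>
        (\<exists>c\<in>P ?\<alpha>. map Some (nths s ({..<D} - ?\<alpha>)) = map Some c)"
      unfolding compl eval_poly_def monomials_of_def mem_Collect_eq nths_pattern[OF True]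
      using True by (simp add: pattern_def)
    also have "\<dots> \<longleftrightarrow> nths s ({..<D} - ?\<alpha>) \<in> P ?\<alpha>"
      by (simp only: inj_map_eq_map[OF inj_Some] bex_simps) blast
    finally show ?thesis using True by blast
  qed (simp add: eval_poly_def monomials_of_def pattern_def)
  show "s \<in> poly_map S D P n \<longleftrightarrow> s \<in> eval_poly (monomials_of D P) n"
  proof
    assume "s \<in> poly_map S D P n"
    then obtain \<alpha> where \<alpha>: "\<alpha> \<subseteq> {..<D}" "s \<in> tuples S D" "nths s ({..<D} - \<alpha>) \<in> P \<alpha>" "\<forall>i\<in>\<alpha>. s ! i \<in> n"
      by (auto simp: poly_map_def)
    have len: "length s = D" using \<alpha>(2) by (simp add: tuples_def)
    have "set (nths s ({..<D} - \<alpha>)) \<subseteq> support D P"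
      by (rule set_coefficient_subset_support[where P = P, OF \<alpha>(3,1)])
    then have "s ! i \<notin> n" if "i < D" "i \<notin> \<alpha>" for i
      using that n(2) len by (auto simp: set_nths)
    then have "\<alpha> = ?\<alpha>" using \<alpha>(1,4) by auto
    then show "s \<in> eval_poly (monomials_of D P) n" using eval len \<alpha>(3) by simp
  next
    assume "s \<in> eval_poly (monomials_of D P) n"
    then have s: "length s = D" "nths s ({..<D} - ?\<alpha>) \<in> P ?\<alpha>" using eval by auto
    have "set (nths s ({..<D} - ?\<alpha>)) \<subseteq> support D P" by (rule set_coefficient_subset_support[where P = P, OF s(2)]) auto
    then have "s ! i \<in> S" if "i < D" for i
      using that n(1) s(1) finite_support(2)[OF P] by (cases "s ! i \<in> n") (auto simp: set_nths)
    then have "s \<in> tuples S D" using s(1) by (auto simp: tuples_def in_set_conv_nth)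
    moreover have "?\<alpha> \<in> Pow {..<D}" by auto
    ultimately show "s \<in> poly_map S D P n" using s(2) unfolding poly_map_def by blast
  qed
qed

lemma poly_map_mono: "n \<subseteq> N \<Longrightarrow> poly_map S D P n \<subseteq> poly_map S D P N"
  by (fastforce simp: poly_map_def)

lemma finite_poly_map:
  assumes "set_polynomial S D P" "finite n"
  shows "finite (poly_map S D P n)"
proof (rule finite_subset)
  show "finite (tuples (n \<union> support D P) D)"
    using assms finite_support finite_tuples by blast
  show "poly_map S D P n \<subseteq> tuples (n \<union> support D P) D"
  proof
    fix s assume "s \<in> poly_map S D P n"
    then obtain \<alpha> where \<alpha>: "\<alpha> \<subseteq> {..<D}" "length s = D" "nths s ({..<D} - \<alpha>) \<in> P \<alpha>" "\<forall>i\<in>\<alpha>. s ! i \<in> n"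
      by (auto simp: poly_map_def tuples_def)
    have "set (nths s ({..<D} - \<alpha>)) \<subseteq> support D P"
      by (rule set_coefficient_subset_support[where P = P, OF \<alpha>(3,1)])
    then have "s ! i \<in> n \<union> support D P" if "i < D" for i
      using that \<alpha>(2,4) by (cases "i \<in> \<alpha>") (auto simp: set_nths)
    then have "set s \<subseteq> n \<union> support D P" using \<alpha>(2) by (metis in_set_conv_nth subsetI)
    then show "s \<in> tuples (n \<union> support D P) D" using \<alpha>(2) by (simp add: tuples_def)
  qed
qed

section \<open>Colourings of compact spaces and recurrence\<close>

lemma compact_finite_colouring:
  fixes X :: "'x::metric_space set"
  assumes "compact X" "\<epsilon> > 0"
  shows "\<exists>(k::nat) col. (\<forall>x. col x < k) \<and> (\<forall>x\<in>X. \<forall>y\<in>X. col x = col y \<longrightarrow> dist x y < \<epsilon>)"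
proof -
  have "X \<subseteq> (\<Union>c\<in>X. ball c (\<epsilon> / 2))" using assms(2) by auto
  then obtain C where C: "finite C" "X \<subseteq> (\<Union>c\<in>C. ball c (\<epsilon> / 2))"
    by (rule compactE_image[OF assms(1) open_ball]) (rule that)
  obtain h where h: "bij_betw h C {0..<card C}" using ex_bij_betw_finite_nat[OF C(1)] by blast
  define g where "g x = (SOME c. c \<in> C \<and> x \<in> ball c (\<epsilon> / 2))" for x
  have g: "g x \<in> C" "x \<in> ball (g x) (\<epsilon> / 2)" if "x \<in> X" for x
    using someI_ex[of "\<lambda>c. c \<in> C \<and> x \<in> ball c (\<epsilon> / 2)"] C(2) that unfolding g_def by blast+
  show ?thesis
  proof (intro exI conjI allI ballI impI)
    \<comment> \<open>Points outside \<open>X\<close> get the default colour 0; the bound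
      \<open>Suc (card C)\<close> admits it even when \<open>C\<close> is empty.\<close>
    show "(if x \<in> X then h (g x) else 0) < Suc (card C)" for x
      using g(1)[of x] bij_betwE[OF h] by (auto simp: less_Suc_eq)
  next
    fix x y assume xy: "x \<in> X" "y \<in> X" "(if x \<in> X then h (g x) else 0) = (if y \<in> X then h (g y) else 0)"
    then have "g x = g y" using g(1) h by (auto simp: bij_betw_def inj_on_def)
    then show "dist x y < \<epsilon>"
      using g(2)[OF xy(1)] g(2)[OF xy(2)] dist_triangle_half_r[of "g x" x \<epsilon> y] by simp
  qed
qed

theorem theorem3p4:
  fixes S :: "'s set" and D :: nat and A :: "'s setpoly set"
  assumes "infinite S" and "D > 0"
    and "poly_system S D A"
    and "\<And>P. P \<in> A \<Longrightarrow> constant_term P = {}"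
  shows "system_of_recurrence TYPE('x::metric_space) S D A"
  unfolding system_of_recurrence_def
proof (intro allI impI; elim conjE)
  fix X :: "'x set" and T :: "'s list set \<Rightarrow> 'x \<Rightarrow> 'x" and \<epsilon> :: real and H :: "'s set"
  assume X: "compact X" and T: "is_action (tuples S D) X T" and \<epsilon>: "\<epsilon> > 0" and H: "H \<in> Fpow S"
  have A: "finite A" "\<And>P. P \<in> A \<Longrightarrow> set_polynomial S D P"
    using assms(3) by (auto simp: poly_system_def)
  \<comment> \<open>Avoiding \<open>K\<close> means avoiding both the prescribed set and all
    constants of the system.\<close>
  define K where "K = H \<union> (\<Union>P\<in>A. support D P)"
  \<comment> \<open>The zero polynomial makes the base itself share the common colour, so that each
    point is compared with \<open>T a x\<close>.\<close>
  define B where "B = insert {} (monomials_of D ` A)"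
  have K: "finite K" using H A finite_support by (auto simp: K_def Fpow_def)
  have "monomials_of D P \<subseteq> monomials D K" if "P \<in> A" for P
  proof -
    have "monomials_of D P \<subseteq> monomials D (support D P)"
      using assms(4)[OF that] by (intro monomials_of_monomials) (simp add: constant_term_def)
    also have "\<dots> \<subseteq> monomials D K" using that by (auto simp: monomials_def K_def)
    finally show ?thesis .
  qed
  then have B: "B \<subseteq> Pow (monomials D K)" by (auto simp: B_def)
  obtain k col where col: "\<And>x. col x < (k::nat)"
    and close: "\<And>x y. x \<in> X \<Longrightarrow> y \<in> X \<Longrightarrow> col x = col y \<Longrightarrow> dist x y < \<epsilon>"
    using compact_finite_colouring[OF X \<epsilon>] by blast
  have "hales_jewett S K D B"
    using polynomial_hales_jewett[OF assms(1) K B] by (simp add: B_def)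
  then obtain N where N: "finite N" "N \<subseteq> S" "N \<inter> K = {}"
    and mono: "\<And>\<phi>. \<forall>b. \<phi> b < k \<Longrightarrow> monochromatic K D B N \<phi>"
    unfolding hales_jewett_def by metis
  \<comment> \<open>Colours must be given to arbitrary sets of tuples. Intersecting with
    \<open>U\<close> first ensures that \<open>T\<close> is applied only to members of its domain,
    and it puts the final base inside the required union.\<close>
  define U where "U = (\<Union>P\<in>A. poly_map S D P N)"
  have U: "U \<in> Fpow (tuples S D)"
  proof -
    have "finite U" unfolding U_def by (intro finite_UN_I A(1) finite_poly_map[OF A(2) N(1)])
    moreover have "U \<subseteq> tuples S D" by (auto simp: U_def poly_map_def)
    ultimately show ?thesis by (simp add: Fpow_def)
  qed
  show "\<exists>N\<in>Fpow S. N \<inter> H = {} \<and> (\<forall>x\<in>X. \<exists>n a. n \<noteq> {} \<and> n \<subseteq> N \<and>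
      a \<subseteq> (\<Union>P\<in>A. poly_map S D P N) \<and> (\<forall>P\<in>A. a \<inter> poly_map S D P n = {} \<and>
        dist (T (a \<union> poly_map S D P n) x) (T a x) < \<epsilon>))"
  proof (intro bexI[of _ N] conjI ballI)
    show "N \<in> Fpow S" "N \<inter> H = {}" using N by (auto simp: Fpow_def K_def)
  next
    fix x assume x: "x \<in> X"
    obtain n a c where n: "n \<noteq> {}" "n \<subseteq> N" and a: "a \<inter> tuples (n \<union> K) D = {}"
      and c: "\<forall>p\<in>B. col (T ((a \<union> eval_poly p n) \<inter> U) x) = c"
      using mono[of "\<lambda>b. col (T (b \<inter> U) x)"] col unfolding monochromatic_def by blast
    have TX: "T b x \<in> X" if "b \<subseteq> U" for b
    proof -
      have "b \<in> Fpow (tuples S D)" using that U by (auto simp: Fpow_def intro: finite_subset)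
      then show ?thesis using T x by (auto simp: is_action_def)
    qed
    have a_col: "col (T (a \<inter> U) x) = c" using c by (auto simp: B_def)
    have "a \<inter> U \<inter> poly_map S D P n = {} \<and> dist (T (a \<inter> U \<union> poly_map S D P n) x) (T (a \<inter> U) x) < \<epsilon>"
      if P: "P \<in> A" for P
    proof
      have ev: "poly_map S D P n = eval_poly (monomials_of D P) n"
        using N n P by (intro poly_map_eq_eval_poly A(2)) (auto simp: K_def)
      show "a \<inter> U \<inter> poly_map S D P n = {}"
        using a eval_poly_subset_tuples[of "monomials_of D P" D K n] B P unfolding ev
        by (auto simp: B_def)
      have sub: "poly_map S D P n \<subseteq> U" using poly_map_mono[OF n(2)] P unfolding U_def by blast
      \<comment> \<open>As P(n) lies in \<open>U\<close>, the intersection affects only the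
        base.\<close>
      then have "(a \<union> eval_poly (monomials_of D P) n) \<inter> U = a \<inter> U \<union> poly_map S D P n"
        unfolding ev by blast
      moreover have "monomials_of D P \<in> B" using P by (simp add: B_def)
      ultimately have "col (T (a \<inter> U \<union> poly_map S D P n) x) = c" using c by metis
      then show "dist (T (a \<inter> U \<union> poly_map S D P n) x) (T (a \<inter> U) x) < \<epsilon>"
        using close TX sub a_col by (metis Int_lower2 Un_least)
    qed
    then show "\<exists>n a. n \<noteq> {} \<and> n \<subseteq> N \<and> a \<subseteq> (\<Union>P\<in>A. poly_map S D P N) \<and>
        (\<forall>P\<in>A. a \<inter> poly_map S D P n = {} \<and> dist (T (a \<union> poly_map S D P n) x) (T a x) < \<epsilon>)"
      using n by (intro exI[of _ n] exI[of _ "a \<inter> U"]) (auto simp: U_def)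
  qed
qed

end
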